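(* Let $a$ be a positive integer and $b$ an integer with $b>-a$, $a$ and $b$ both odd, and $\gcd(a,b)=1$. Then the set $\{x(ax+b)/2:\ x\in\mathbb{N}\}$ is an asymptotic base of order four. Moreover, for any $n\in\mathbb{N}$ with $$n>2a(7a(a-1)+1)+(7a-2)b+(2a(2a-1)+b)\sqrt{6(2a(a-1)+b)},$$ there are $w,x,y,z\in\mathbb{N}$ such that $$n=\frac{w(aw+b)}2+\frac{x(ax+b)}2+\frac{y(ay+b)}2+\frac{z(az+b)}2.$$
   Context: $\mathbb{N}=\{0,1,2,\ldots\}$. A subset $A\subseteq\mathbb{N}$ is called an asymptotic base of order $k$ if $\mathbb{N}\setminus kA$ is finite, where $kA=\{a_1+\cdots+a_k:\ a_1,\ldots,a_k\in A\}$. *)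

theory Defs
  imports Complex_Main
begin

definition sumset_power :: "nat \<Rightarrow> real set \<Rightarrow> real set" where
  "sumset_power k A = {\<Sum>i<k. f i | f. \<forall>i<k. f i \<in> A}"

text \<open>
  The natural numbers are taken as the subset \<open>\<nat>\<close> of the reals, so that a set given by
  a formula with division must actually consist of natural numbers in order to be a base.
\<close>

definition asymptotic_base :: "nat \<Rightarrow> real set \<Rightarrow> bool" where
  "asymptotic_base k A \<longleftrightarrow> A \<subseteq> \<nat> \<and> finite (\<nat> - sumset_power k A)"

end

theory Submission
  imports Defs "HOL-Computational_Algebra.Formal_Laurent_Series"
begin

text \<open>
  Writing \<open>2 n = a S + b T\<close>, it suffices to find odd integers \<open>S, T\<close> with \<open>T \<ge> 0\<close>, \<open>T\<^sup>2 < 4 S\<close> and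
  \<open>3 S < T\<^sup>2 + 2 T + 4\<close>: by Cauchy's lemma \<open>S\<close> and \<open>T\<close> are then the sum of the squares and the sum of
  four common natural numbers. The odd \<open>T\<close> with \<open>a dvd 2 n - b T\<close> form a residue class modulo \<open>2 a\<close>,
  and the inequalities confine \<open>T\<close> to an open interval, which is longer than \<open>2 a\<close> exactly under the
  stated bound on \<open>n\<close>.

  Cauchy's lemma rests on the theorem of Gauss that every natural number is a sum of three
  triangular numbers. It follows from Andrews' identity for the cube of
  \<open>\<psi>(q) = \<Sum>\<^sub>s q ^ (s (s + 1) / 2)\<close>,
  \<open>\<psi>(q)\<^sup>3 = \<Sum>\<^sub>r \<Sum>\<^sub>j\<^sub>\<le>\<^sub>2\<^sub>r q ^ (2 r\<^sup>2 + 2 r - j (j + 1) / 2) (1 + q ^ (2 r + 1)) / (1 - q ^ (2 r + 1))\<close>,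
  whose right-hand side has positive coefficients because of the summand \<open>(1 + q) / (1 - q)\<close> for
  \<open>r = 0\<close>. The identity is proved in a finite form with the Bailey pair method, over any field
  containing an element \<open>q\<close> that is not a root of unity, and then read off modulo powers of \<open>q\<close> in
  the field of Laurent series.
\<close>

section \<open>A finite form of Andrews' identity\<close>

text \<open>In the usual notation, \<open>even_fac q n\<close> is \<open>(q\<^sup>2; q\<^sup>2)\<^sub>n\<close> and \<open>odd_fac q n\<close> is \<open>(q; q\<^sup>2)\<^sub>n\<close>.\<close>

definition even_fac :: "'a::field \<Rightarrow> nat \<Rightarrow> 'a" where
  "even_fac q n = (\<Prod>i<n. 1 - q ^ (2 * i + 2))"

definition odd_fac :: "'a::field \<Rightarrow> nat \<Rightarrow> 'a" where
  "odd_fac q n = (\<Prod>i<n. 1 - q ^ (2 * i + 1))"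

definition tri :: "nat \<Rightarrow> nat" where
  "tri n = n * (n + 1) div 2"

lemma tri_0 [simp]: "tri 0 = 0"
  by (simp add: tri_def)

lemma tri_Suc: "tri (Suc n) = tri n + Suc n"
  by (simp add: tri_def)

lemma two_tri: "2 * tri n = n * (n + 1)"
  by (simp add: tri_def)

lemma tri_even: "tri (2 * n) = n * (2 * n + 1)"
  using two_tri[of "2 * n"] by simp

lemma tri_odd: "tri (2 * n + 1) = (n + 1) * (2 * n + 1)"
  using two_tri[of "2 * n + 1"] by (simp add: algebra_simps)

lemma even_fac_0 [simp]: "even_fac q 0 = 1"
  by (simp add: even_fac_def)

lemma even_fac_Suc: "even_fac q (Suc n) = even_fac q n * (1 - q ^ (2 * n + 2))"
  by (simp add: even_fac_def)

lemma odd_fac_0 [simp]: "odd_fac q 0 = 1"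
  by (simp add: odd_fac_def)

lemma odd_fac_Suc: "odd_fac q (Suc n) = odd_fac q n * (1 - q ^ (2 * n + 1))"
  by (simp add: odd_fac_def)

text \<open>Pairs the terms at equal distance from \<open>n\<close>. It is applied with
  \<open>m = n\<close>, where the range is \<open>{0..2 * n}\<close>; a separate \<open>m\<close>
  lets the induction keep the centre fixed.\<close>

lemma sum_centered:
  fixes h :: "nat \<Rightarrow> 'a::comm_monoid_add"
  assumes "m \<le> n"
  shows "(\<Sum>k\<in>{n - m..n + m}. h k) = h n + (\<Sum>s<m. h (n - Suc s) + h (n + Suc s))"
  using assms
proof (induction m)
  case (Suc m)
  have "{n - Suc m..n + Suc m} = insert (n - Suc m) (insert (n + Suc m) {n - m..n + m})"
    using Suc.prems by auto
  moreover have "n - Suc m \<notin> insert (n + Suc m) {n - m..n + m}" "n + Suc m \<notin> {n - m..n + m}"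
    using Suc.prems by auto
  ultimately have "(\<Sum>k\<in>{n - Suc m..n + Suc m}. h k)
      = h (n - Suc m) + (h (n + Suc m) + (\<Sum>k\<in>{n - m..n + m}. h k))"
    by simp
  then show ?case
    using Suc by (simp add: ac_simps)
qed simp

section \<open>Evaluation of a Rogers-Szego polynomial\<close>

locale generic_base =
  fixes q :: "'a::field"
  assumes q_nonzero [simp]: "q \<noteq> 0"
    and q_not_root_of_unity: "k > 0 \<Longrightarrow> q ^ k \<noteq> 1"
begin

lemma one_minus_power_nonzero [simp]: "k > 0 \<Longrightarrow> 1 - q ^ k \<noteq> 0"
  using q_not_root_of_unity[of k] by auto

lemma even_fac_nonzero [simp]: "even_fac q n \<noteq> 0"
proof -
  have "1 - q ^ (2 * i + 2) \<noteq> 0" for i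
    by (rule one_minus_power_nonzero) simp
  then show ?thesis
    unfolding even_fac_def by (subst prod_zero_iff) blast+
qed

lemma odd_fac_nonzero [simp]: "odd_fac q n \<noteq> 0"
proof -
  have "1 - q ^ (2 * i + 1) \<noteq> 0" for i
    by (rule one_minus_power_nonzero) simp
  then show ?thesis
    unfolding odd_fac_def by (subst prod_zero_iff) blast+
qed

text \<open>The Rogers-Szego polynomial \<open>H_n(z; q^2)\<close> at \<open>z = q\<close>, divided
  by \<open>(q^2; q^2)_n\<close>. At this point it factors completely.\<close>

definition rogers_szego :: "nat \<Rightarrow> 'a" where
  "rogers_szego n = (\<Sum>k\<le>n. q ^ k / (even_fac q k * even_fac q (n - k)))"

lemma div_even_fac_Suc: "(1 - q ^ (2 * n + 2)) / even_fac q (Suc n) = 1 / even_fac q n"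
  using one_minus_power_nonzero[of "2 * n + 2"]
  by (simp add: even_fac_Suc del: one_minus_power_nonzero right_minus_eq)

text \<open>The factor \<open>1 - q ^ (2 * k)\<close> kills the term \<open>k = 0\<close> and
  cancels the last factor of \<open>even_fac q k\<close> in the others. The companion
  \<open>rogers_szego_shift'\<close> treats \<open>even_fac q (Suc n - k)\<close> likewise.\<close>

lemma rogers_szego_shift:
  "(\<Sum>k\<le>Suc n. (1 - q ^ (2 * k)) * (q ^ k / (even_fac q k * even_fac q (Suc n - k)))) = q * rogers_szego n"
proof -
  have "(\<Sum>k\<le>Suc n. (1 - q ^ (2 * k)) * (q ^ k / (even_fac q k * even_fac q (Suc n - k))))
      = (\<Sum>k\<le>n. (1 - q ^ (2 * k + 2)) * (q ^ Suc k / (even_fac q (Suc k) * even_fac q (n - k))))"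
    by (subst sum.atMost_Suc_shift) simp
  also have "\<dots> = (\<Sum>k\<le>n. q * (q ^ k / (even_fac q k * even_fac q (n - k))))"
  proof (rule sum.cong)
    fix k
    have "(1 - q ^ (2 * k + 2)) * (q ^ Suc k / (even_fac q (Suc k) * even_fac q (n - k)))
        = (1 - q ^ (2 * k + 2)) / even_fac q (Suc k) * (q ^ Suc k / even_fac q (n - k))"
      by simp
    then show "(1 - q ^ (2 * k + 2)) * (q ^ Suc k / (even_fac q (Suc k) * even_fac q (n - k)))
        = q * (q ^ k / (even_fac q k * even_fac q (n - k)))"
      unfolding div_even_fac_Suc by simp
  qed simp
  finally show ?thesis
    by (simp add: rogers_szego_def sum_distrib_left)
qed

lemma rogers_szego_shift':
  "(\<Sum>k\<le>Suc n. q ^ (2 * k) * (1 - q ^ (2 * (Suc n - k))) * (q ^ k / (even_fac q k * even_fac q (Suc n - k))))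
   = (\<Sum>k\<le>n. q ^ (2 * k) * (q ^ k / (even_fac q k * even_fac q (n - k))))"
proof -
  have "(\<Sum>k\<le>Suc n. q ^ (2 * k) * (1 - q ^ (2 * (Suc n - k))) * (q ^ k / (even_fac q k * even_fac q (Suc n - k))))
     = (\<Sum>k\<le>n. q ^ (2 * k) * (1 - q ^ (2 * (Suc n - k))) * (q ^ k / (even_fac q k * even_fac q (Suc n - k))))"
    by simp
  also have "\<dots> = (\<Sum>k\<le>n. q ^ (2 * k) * (q ^ k / (even_fac q k * even_fac q (n - k))))"
  proof (rule sum.cong)
    fix k assume "k \<in> {..n}"
    then have k: "Suc n - k = Suc (n - k)" "2 * Suc (n - k) = 2 * (n - k) + 2"
      by (simp_all add: Suc_diff_le)
    have "q ^ (2 * k) * (1 - q ^ (2 * (n - k) + 2)) * (q ^ k / (even_fac q k * even_fac q (Suc (n - k))))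
        = (1 - q ^ (2 * (n - k) + 2)) / even_fac q (Suc (n - k)) * (q ^ (2 * k) * q ^ k / even_fac q k)"
      by (simp add: mult_ac)
    then show "q ^ (2 * k) * (1 - q ^ (2 * (Suc n - k))) * (q ^ k / (even_fac q k * even_fac q (Suc n - k)))
        = q ^ (2 * k) * (q ^ k / (even_fac q k * even_fac q (n - k)))"
      unfolding k div_even_fac_Suc by simp
  qed simp
  finally show ?thesis .
qed

text \<open>Inside the sum, \<open>1 - q ^ (2 * n + 4)\<close> splits as \<open>(1 - q ^ (2 * k)) +
  q ^ (2 * k) * (1 - q ^ (2 * (n + 2 - k)))\<close>, one part for each of the shift lemmas.\<close>

lemma rogers_szego_rec:
  "(1 - q ^ (2 * n + 4)) * rogers_szego (Suc (Suc n)) = (1 + q) * rogers_szego (Suc n) - q * rogers_szego n"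
proof -
  let ?t = "\<lambda>n k. q ^ k / (even_fac q k * even_fac q (n - k))"
  have "(1 - q ^ (2 * n + 4)) * rogers_szego (Suc (Suc n)) =
    (\<Sum>k\<le>Suc (Suc n). (1 - q ^ (2 * k)) * ?t (Suc (Suc n)) k
       + q ^ (2 * k) * (1 - q ^ (2 * (Suc (Suc n) - k))) * ?t (Suc (Suc n)) k)"
    unfolding rogers_szego_def sum_distrib_left
  proof (rule sum.cong)
    fix k assume k: "k \<in> {..Suc (Suc n)}"
    have "q ^ (2 * n + 4) = q ^ (2 * k) * q ^ (2 * (Suc (Suc n) - k))"
      unfolding power_add[symmetric] by (rule arg_cong[where f = "power q"]) (use k in auto)
    then show "(1 - q ^ (2 * n + 4)) * ?t (Suc (Suc n)) k = (1 - q ^ (2 * k)) * ?t (Suc (Suc n)) k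
       + q ^ (2 * k) * (1 - q ^ (2 * (Suc (Suc n) - k))) * ?t (Suc (Suc n)) k"
      unfolding distrib_right[symmetric] by (simp add: algebra_simps)
  qed simp
  also have "\<dots> = q * rogers_szego (Suc n) + (\<Sum>k\<le>Suc n. q ^ (2 * k) * ?t (Suc n) k)"
    unfolding sum.distrib rogers_szego_shift rogers_szego_shift' ..
  \<comment> \<open>Write \<open>q ^ (2 * k)\<close> as \<open>1 - (1 - q ^ (2 * k))\<close>; the
    second part is a shifted sum again.\<close>
  also have "(\<Sum>k\<le>Suc n. q ^ (2 * k) * ?t (Suc n) k) = rogers_szego (Suc n) - q * rogers_szego n"
    unfolding rogers_szego_shift[symmetric] rogers_szego_def[of "Suc n"] sum_subtractf[symmetric]
    by (rule sum.cong) (simp_all add: left_diff_distrib diff_divide_distrib)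
  finally show ?thesis
    by (simp add: algebra_simps)
qed

text \<open>The closed form obeys the recurrence \<open>rogers_szego_rec\<close> and has the same
  values at \<open>0\<close> and \<open>1\<close>.\<close>

lemma rogers_szego_eq: "rogers_szego n = (\<Prod>i<n. 1 + q ^ Suc i) / even_fac q n"
proof (induction n rule: less_induct)
  case (less n)
  consider "n = 0" | "n = 1" | m where "n = Suc (Suc m)"
    by (cases n rule: nat.exhaust; metis One_nat_def not0_implies_Suc)
  then show ?case
  proof cases
    case 3
    let ?h = "\<lambda>n. (\<Prod>i<n. 1 + q ^ Suc i)"
    have nz: "1 - q ^ (2 * m + 4) \<noteq> 0" "1 - q ^ (2 * m + 2) \<noteq> 0"
      by (rule one_minus_power_nonzero, simp)+
    have IH: "rogers_szego (Suc m) = ?h m * (1 + q ^ Suc m) / (even_fac q m * (1 - q ^ (2 * m + 2)))"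
      "rogers_szego m = ?h m / even_fac q m"
      using less[of "Suc m"] less[of m] 3 by (simp_all add: even_fac_Suc)
    have "(1 - q ^ (2 * m + 4)) * rogers_szego n =
      ?h m / (even_fac q m * (1 - q ^ (2 * m + 2))) * ((1 + q) * (1 + q ^ Suc m) - q * (1 - q ^ (2 * m + 2)))"
      unfolding 3 rogers_szego_rec IH using nz(2) even_fac_nonzero[of m]
      by (simp add: divide_simps del: one_minus_power_nonzero right_minus_eq even_fac_nonzero power_Suc)
        (simp add: algebra_simps)
    also have "(1 + q) * (1 + q ^ Suc m) - q * (1 - q ^ (2 * m + 2)) = (1 + q ^ Suc m) * (1 + q ^ Suc (Suc m))"
      by (simp add: algebra_simps power_add mult_2_right power2_eq_square)
    also have "?h m / (even_fac q m * (1 - q ^ (2 * m + 2))) * ((1 + q ^ Suc m) * (1 + q ^ Suc (Suc m)))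
        = (1 - q ^ (2 * m + 4)) * (?h n / even_fac q n)"
    proof -
      have "even_fac q n = even_fac q m * (1 - q ^ (2 * m + 2)) * (1 - q ^ (2 * m + 4))"
        by (simp add: 3 even_fac_Suc eval_nat_numeral)
      then show ?thesis
        unfolding 3 prod.lessThan_Suc using nz
        by (simp add: mult.assoc del: one_minus_power_nonzero right_minus_eq power_Suc)
    qed
    finally show ?thesis
      using mult_left_cancel[OF nz(1)] by blast
  next
    case 2
    have "1 - q \<noteq> 0" "1 - q^2 \<noteq> 0"
      using one_minus_power_nonzero[of 1] one_minus_power_nonzero[of 2] by (simp_all)
    then show ?thesis
      unfolding 2 rogers_szego_def by (simp add: even_fac_def numeral_2_eq_2 add_divide_distrib)
  qed (simp add: rogers_szego_def)
qed

lemma prod_one_minus_power_split: "(\<Prod>i<2 * n. 1 - q ^ Suc i) = odd_fac q n * even_fac q n"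
  by (induction n) (simp_all add: odd_fac_Suc even_fac_Suc mult_ac)

text \<open>Factoring each \<open>1 - q ^ (2 * i + 2)\<close> as a difference of squares cancels the
  numerator of \<open>rogers_szego_eq\<close>; what remains splits into odd and even
  exponents.\<close>

lemma rogers_szego_double: "rogers_szego (2 * n) = 1 / (odd_fac q n * even_fac q n)"
proof -
  have "even_fac q (2 * n) = (\<Prod>i<2 * n. 1 + q ^ Suc i) * (\<Prod>i<2 * n. 1 - q ^ Suc i)"
    unfolding even_fac_def prod.distrib[symmetric]
    by (rule prod.cong) (simp_all add: algebra_simps mult_2_right power_add)
  then have *: "even_fac q (2 * n) = (\<Prod>i<2 * n. 1 + q ^ Suc i) * (odd_fac q n * even_fac q n)"
    by (simp only: prod_one_minus_power_split)
  moreover have "(\<Prod>i<2 * n. 1 + q ^ Suc i) \<noteq> 0"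
    using * even_fac_nonzero[of "2 * n"] by (metis mult_zero_left)
  ultimately show ?thesis
    unfolding rogers_szego_eq by (simp only: divide_simps) simp
qed

section \<open>The Bailey pair and its conjugate\<close>

definition neg_tri_sum :: "nat \<Rightarrow> 'a" where
  "neg_tri_sum r = (\<Sum>j\<le>2 * r. 1 / q ^ tri j)"

text \<open>The \<alpha>-sequence of a Bailey pair relative to \<open>q^2\<close> in base
  \<open>q^2\<close>, up to normalisation; \<open>bailey_pair\<close> evaluates its
  \<beta>-sequence.\<close>

definition bailey_alpha :: "nat \<Rightarrow> 'a" where
  "bailey_alpha r = (1 - q ^ (4 * r + 2)) * q ^ (2 * r\<^sup>2) * neg_tri_sum r"

text \<open>Over a common denominator this is
  \<open>1 - q ^ (4 * r + 2) = ?y - q ^ (4 * r + 2) * ?x\<close>, with \<open>?x\<close> and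
  \<open>?y\<close> the last factors of the two larger factorials. It prepares a summation by
  parts.\<close>

lemma bailey_alpha_telescope:
  assumes "r < n"
  shows "(1 - q ^ (4 * r + 2)) * q ^ (2 * r\<^sup>2) / (even_fac q (n - r) * even_fac q (n + r + 1))
     = q ^ (2 * r\<^sup>2) / (even_fac q (n - r) * even_fac q (n + r))
     - q ^ (2 * (Suc r)\<^sup>2) / (even_fac q (n - Suc r) * even_fac q (n + Suc r))"
proof -
  obtain d where d: "n = r + d + 1"
    using assms by (metis add.commute less_iff_Suc_add plus_1_eq_Suc add.assoc)
  let ?x = "1 - q ^ (2 * d + 2)" and ?y = "1 - q ^ (2 * (2 * r + d + 1) + 2)"
  have nz: "?x \<noteq> 0" "?y \<noteq> 0"
    by (rule one_minus_power_nonzero, simp)+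
  have e: "even_fac q (n - r) = even_fac q d * ?x"
     "even_fac q (n + r + 1) = even_fac q (2 * r + d + 1) * ?y"
     "even_fac q (n + Suc r) = even_fac q (2 * r + d + 1) * ?y"
     "even_fac q (n + r) = even_fac q (2 * r + d + 1)"
     "even_fac q (n - Suc r) = even_fac q d"
    unfolding d using even_fac_Suc[of q d] even_fac_Suc[of q "2 * r + d + 1"]
    by (simp_all add: mult_2 mult_2_right ac_simps)
  have s: "q ^ (2 * (Suc r)\<^sup>2) = q ^ (2 * r\<^sup>2) * q ^ (4 * r + 2)"
    unfolding power_add[symmetric] by (simp add: power2_eq_square algebra_simps)
  have t: "q ^ (2 * (2 * r + d + 1) + 2) = q ^ (4 * r + 2) * q ^ (2 * d + 2)"
    unfolding power_add[symmetric] by (simp add: algebra_simps)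
  have "?y - q ^ (4 * r + 2) * ?x = 1 - q ^ (4 * r + 2)"
    unfolding t by (simp add: algebra_simps)
  then have k: "1 - q ^ (4 * r + 2) = ?y - q ^ (4 * r + 2) * ?x" ..
  show ?thesis
    unfolding e s k using nz even_fac_nonzero
    by (simp add: divide_simps del: one_minus_power_nonzero right_minus_eq) (simp add: algebra_simps)
qed

text \<open>The two new exponents \<open>tri (2 * r + 1)\<close> and \<open>tri (2 * r + 2)\<close>
  lie at distance \<open>r + 1\<close> on either side of \<open>2 * (r + 1)^2\<close>.\<close>

lemma neg_tri_sum_Suc:
  "q ^ (2 * (Suc r)\<^sup>2) * (neg_tri_sum (Suc r) - neg_tri_sum r) = q ^ Suc r + 1 / q ^ Suc r"
proof -
  have t: "tri (2 * r + 1) + Suc r = 2 * (Suc r)\<^sup>2" "tri (2 * r + 2) = 2 * (Suc r)\<^sup>2 + Suc r"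
    using tri_odd[of r] tri_even[of "Suc r"] by (simp_all add: power2_eq_square algebra_simps)
  have "neg_tri_sum (Suc r) - neg_tri_sum r = 1 / q ^ tri (2 * r + 1) + 1 / q ^ tri (2 * r + 2)"
    by (simp add: neg_tri_sum_def)
  moreover have "q ^ (2 * (Suc r)\<^sup>2) / q ^ tri (2 * r + 1) = q ^ Suc r"
    unfolding t(1)[symmetric] power_add by simp
  moreover have "q ^ (2 * (Suc r)\<^sup>2) / q ^ tri (2 * r + 2) = 1 / q ^ Suc r"
    unfolding t(2) power_add by simp
  ultimately show ?thesis
    by (simp add: distrib_left)
qed

text \<open>Summation by parts replaces \<open>neg_tri_sum\<close> by its differences. The result is
  a sum arranged symmetrically about \<open>k = n\<close>, namely
  \<open>rogers_szego (2 * n)\<close> divided by \<open>q ^ n\<close>.\<close>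

lemma bailey_pair:
  "(\<Sum>r\<le>n. bailey_alpha r / (even_fac q (n - r) * even_fac q (n + r + 1)))
   = 1 / (q ^ n * odd_fac q n * even_fac q n)"
proof -
  let ?g = "\<lambda>r. q ^ (2 * r\<^sup>2) / (even_fac q (n - r) * even_fac q (n + r))"
  let ?T = "\<lambda>r. bailey_alpha r / (even_fac q (n - r) * even_fac q (n + r + 1))"
  let ?h = "\<lambda>k. q ^ k / (even_fac q k * even_fac q (2 * n - k))"
  have less: "?T r = ?g r * neg_tri_sum r - ?g (Suc r) * neg_tri_sum r" if "r < n" for r
  proof -
    have "?T r = (1 - q ^ (4 * r + 2)) * q ^ (2 * r\<^sup>2) / (even_fac q (n - r) * even_fac q (n + r + 1)) * neg_tri_sum r"
      by (simp add: bailey_alpha_def)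
    then show ?thesis
      unfolding bailey_alpha_telescope[OF that] by (simp add: algebra_simps)
  qed
  have nz: "1 - q ^ (4 * n + 2) \<noteq> 0"
    by (rule one_minus_power_nonzero) simp
  \<comment> \<open>The telescoping identity needs \<open>r < n\<close>; at \<open>r = n\<close> the
    factor \<open>1 - q ^ (4 * n + 2)\<close> cancels the last factor of
    \<open>even_fac q (2 * n + 1)\<close> instead.\<close>
  have top: "?T n = ?g n * neg_tri_sum n"
    using nz even_fac_Suc[of q "2 * n"]
    by (simp add: bailey_alpha_def mult_2[symmetric] del: one_minus_power_nonzero right_minus_eq)
  have "(\<Sum>r\<le>n. ?T r) = (\<Sum>r<n. ?g r * neg_tri_sum r - ?g (Suc r) * neg_tri_sum r) + ?g n * neg_tri_sum n"
    unfolding lessThan_Suc_atMost[symmetric] sum.lessThan_Suc top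
    by (intro arg_cong2[where f = "(+)"] sum.cong) (simp_all only: less lessThan_iff)
  also have "\<dots> = (\<Sum>r<Suc n. ?g r * neg_tri_sum r) - (\<Sum>r<n. ?g (Suc r) * neg_tri_sum r)"
    by (simp only: sum_subtractf sum.lessThan_Suc) (simp add: algebra_simps)
  also have "\<dots> = ?g 0 * neg_tri_sum 0 + (\<Sum>r<n. ?g (Suc r) * neg_tri_sum (Suc r) - ?g (Suc r) * neg_tri_sum r)"
    unfolding sum.lessThan_Suc_shift sum_subtractf by (simp only: add_diff_eq)
  also have "\<dots> = ?g 0 + (\<Sum>r<n. (q ^ Suc r + 1 / q ^ Suc r) / (even_fac q (n - Suc r) * even_fac q (n + Suc r)))"
    unfolding neg_tri_sum_Suc[symmetric] right_diff_distrib[symmetric]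
    by (simp add: neg_tri_sum_def)
  also have "\<dots> = 1 / q ^ n * (?h n + (\<Sum>s<n. ?h (n - Suc s) + ?h (n + Suc s)))"
  proof -
    have "?g 0 = 1 / q ^ n * ?h n"
      by simp
    moreover have "(q ^ Suc s + 1 / q ^ Suc s) / (even_fac q (n - Suc s) * even_fac q (n + Suc s))
        = 1 / q ^ n * (?h (n - Suc s) + ?h (n + Suc s))" if s: "s < n" for s
    proof -
      have i: "2 * n - (n - Suc s) = n + Suc s" "2 * n - (n + Suc s) = n - Suc s"
        using s by auto
      have "q ^ n = q ^ (n - Suc s) * q ^ Suc s"
        unfolding power_add[symmetric] using s by simp
      then show ?thesis
        unfolding i power_add by (simp add: field_simps del: power_Suc)
    qed
    ultimately show ?thesis
      unfolding distrib_left sum_distrib_left by simp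
  qed
  also have "?h n + (\<Sum>s<n. ?h (n - Suc s) + ?h (n + Suc s)) = rogers_szego (2 * n)"
    using sum_centered[of n n ?h] by (simp add: rogers_szego_def atLeast0AtMost mult_2)
  finally show ?thesis
    by (simp add: rogers_szego_double mult.assoc)
qed

text \<open>The partial sums have a closed form, so this instance of the \<open>q\<close>-Gauss sum telescopes.\<close>

lemma conjugate_bailey_pair:
  assumes "r \<le> N"
  shows "(\<Sum>n\<in>{r..N}. (odd_fac q n)\<^sup>2 * q ^ (2 * n) / (even_fac q (n - r) * even_fac q (n + r + 1)))
   = q ^ (2 * r) * (odd_fac q (Suc N))\<^sup>2 / ((1 - q ^ (2 * r + 1))\<^sup>2 * even_fac q (N - r) * even_fac q (N + r + 1))"
  using assms
proof (induction N rule: dec_induct)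
  case base
  have "1 - q ^ (2 * r + 1) \<noteq> 0"
    by (rule one_minus_power_nonzero) simp
  then show ?case
    by (simp add: odd_fac_Suc power_mult_distrib)
next
  case (step N)
  obtain d where d: "N = r + d"
    using step.hyps le_Suc_ex by blast
  let ?A = "1 - q ^ (2 * r + 1)" and ?o = "odd_fac q (Suc N)"
  let ?x = "1 - q ^ (2 * d + 2)" and ?y = "1 - q ^ (2 * (2 * r + d + 1) + 2)" and ?z = "1 - q ^ (2 * N + 3)"
  let ?a = "even_fac q d" and ?b = "even_fac q (2 * r + d + 1)"
  have nz: "?A \<noteq> 0" "?x \<noteq> 0" "?y \<noteq> 0"
    by (rule one_minus_power_nonzero, simp)+
  have e: "even_fac q (N - r) = ?a" "even_fac q (N + r + 1) = ?b"
    "even_fac q (Suc N - r) = ?a * ?x" "even_fac q (Suc N + r + 1) = ?b * ?y"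
    "odd_fac q (Suc (Suc N)) = ?o * ?z"
    using even_fac_Suc[of q d] even_fac_Suc[of q "2 * r + d + 1"] odd_fac_Suc[of q "Suc N"]
    by (simp_all add: d mult_2 mult_2_right eval_nat_numeral ac_simps)
  have t: "q ^ (2 * Suc N) = q ^ (2 * r) * q ^ (2 * d + 2)"
    "q ^ (2 * (2 * r + d + 1) + 2) = (q ^ (2 * r + 1))\<^sup>2 * q ^ (2 * d + 2)"
    "q ^ (2 * N + 3) = q ^ (2 * r + 1) * q ^ (2 * d + 2)"
    unfolding power_add[symmetric] power_mult[symmetric] d
    by (rule arg_cong[where f = "power q"]; simp)+
  \<comment> \<open>With \<open>p = q ^ (2 * r + 1)\<close> and \<open>Q = q ^ (2 * d + 2)\<close>,
    this is \<open>(1 - Q) * (1 - p^2 * Q) + Q * (1 - p)^2 = (1 - p * Q)^2\<close>.\<close>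
  have key: "?x * ?y + q ^ (2 * d + 2) * ?A\<^sup>2 = ?z\<^sup>2"
    unfolding t by (simp only: power2_eq_square) (simp only: algebra_simps mult_1_left mult_1_right)
  let ?F = "\<lambda>n. (odd_fac q n)\<^sup>2 * q ^ (2 * n) / (even_fac q (n - r) * even_fac q (n + r + 1))"
  have "(\<Sum>n\<in>{r..Suc N}. ?F n) = (\<Sum>n\<in>{r..N}. ?F n) + ?F (Suc N)"
    using step.hyps by simp
  also have "\<dots> = q ^ (2 * r) * ?o\<^sup>2 / (?A\<^sup>2 * ?a * ?b) + ?o\<^sup>2 * (q ^ (2 * r) * q ^ (2 * d + 2)) / (?a * ?x * (?b * ?y))"
    unfolding step.IH e t(1) ..
  also have "\<dots> = q ^ (2 * r) * ?o\<^sup>2 * (?x * ?y + q ^ (2 * d + 2) * ?A\<^sup>2) / (?A\<^sup>2 * (?a * ?x) * (?b * ?y))"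
    using nz by (simp add: divide_simps del: one_minus_power_nonzero right_minus_eq) (simp add: algebra_simps)
  also have "\<dots> = q ^ (2 * r) * (?o * ?z)\<^sup>2 / (?A\<^sup>2 * (?a * ?x) * (?b * ?y))"
    unfolding key by (simp add: power_mult_distrib mult_ac)
  finally show ?case
    unfolding e .
qed

section \<open>The Bailey transform\<close>

text \<open>A partial product of Gauss's product formula for \<psi>.\<close>

definition fac_ratio :: "nat \<Rightarrow> 'a" where
  "fac_ratio n = even_fac q n / odd_fac q n"

lemma fac_ratio_nonzero [simp]: "fac_ratio n \<noteq> 0"
  by (simp add: fac_ratio_def)

text \<open>Expand each \<open>q ^ n / fac_ratio n\<close> by \<open>bailey_pair\<close> and
  interchange the sums; \<open>conjugate_bailey_pair\<close> evaluates the inner ones. As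
  \<open>N\<close> grows, the left side tends to the cube of \<psi> and the last factor on the right
  to \<open>1\<close>.\<close>

lemma andrews_finite:
  "(fac_ratio (Suc N))\<^sup>2 * (\<Sum>n\<le>N. q ^ n / fac_ratio n)
   = (\<Sum>r\<le>N. q ^ (2 * r\<^sup>2 + 2 * r) * neg_tri_sum r * (1 + q ^ (2 * r + 1)) / (1 - q ^ (2 * r + 1))
        * ((even_fac q (Suc N))\<^sup>2 / (even_fac q (N - r) * even_fac q (N + r + 1))))"
proof -
  have "(\<Sum>n\<le>N. q ^ n / fac_ratio n)
    = (\<Sum>n\<le>N. \<Sum>r\<le>n. (odd_fac q n)\<^sup>2 * q ^ (2 * n) / (even_fac q (n - r) * even_fac q (n + r + 1)) * bailey_alpha r)"
  proof (rule sum.cong)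
    fix n
    have "q ^ n / fac_ratio n = (odd_fac q n)\<^sup>2 * q ^ (2 * n) * (1 / (q ^ n * odd_fac q n * even_fac q n))"
      by (simp add: fac_ratio_def power2_eq_square mult_2 power_add)
    then show "q ^ n / fac_ratio n = (\<Sum>r\<le>n. (odd_fac q n)\<^sup>2 * q ^ (2 * n) / (even_fac q (n - r) * even_fac q (n + r + 1)) * bailey_alpha r)"
      unfolding bailey_pair[symmetric] sum_distrib_left by simp
  qed simp
  also have "\<dots> = (\<Sum>r\<le>N. \<Sum>n\<in>{r..N}. (odd_fac q n)\<^sup>2 * q ^ (2 * n) / (even_fac q (n - r) * even_fac q (n + r + 1)) * bailey_alpha r)"
    unfolding sum.Sigma[OF finite_atMost ballI[OF finite_atMost]] sum.Sigma[OF finite_atMost ballI[OF finite_atLeastAtMost]]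
    by (rule sum.reindex_bij_witness[of _ prod.swap prod.swap]) auto
  also have "\<dots> = (\<Sum>r\<le>N. q ^ (2 * r) * (odd_fac q (Suc N))\<^sup>2 / ((1 - q ^ (2 * r + 1))\<^sup>2 * even_fac q (N - r) * even_fac q (N + r + 1)) * bailey_alpha r)"
    unfolding sum_distrib_right[symmetric] by (rule sum.cong) (simp_all only: conjugate_bailey_pair atMost_iff)
  finally have *: "(\<Sum>n\<le>N. q ^ n / fac_ratio n) = \<dots>" .
  show ?thesis
    unfolding * sum_distrib_left
  proof (rule sum.cong)
    fix r
    let ?A = "1 - q ^ (2 * r + 1)"
    have nz: "?A \<noteq> 0"
      by (rule one_minus_power_nonzero) simp
    \<comment> \<open>One of the two factors \<open>?A\<close> in the denominator cancels against
      this factor of \<open>bailey_alpha\<close>.\<close>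
    have s: "1 - q ^ (4 * r + 2) = ?A * (1 + q ^ (2 * r + 1))"
      by (simp add: algebra_simps power_add[symmetric])
    show "(fac_ratio (Suc N))\<^sup>2 * (q ^ (2 * r) * (odd_fac q (Suc N))\<^sup>2 / (?A\<^sup>2 * even_fac q (N - r) * even_fac q (N + r + 1)) * bailey_alpha r)
      = q ^ (2 * r\<^sup>2 + 2 * r) * neg_tri_sum r * (1 + q ^ (2 * r + 1)) / ?A
        * ((even_fac q (Suc N))\<^sup>2 / (even_fac q (N - r) * even_fac q (N + r + 1)))"
      unfolding bailey_alpha_def s fac_ratio_def power_add[of q "2 * r\<^sup>2"] power_divide
      using nz by (simp add: divide_simps power2_eq_square del: one_minus_power_nonzero right_minus_eq power_Suc)
  qed simp
qed

section \<open>A finite product formula for \<psi>\<close>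

lemma fac_ratio_Suc: "fac_ratio (Suc n) = fac_ratio n * (1 - q ^ (2 * n + 2)) / (1 - q ^ (2 * n + 1))"
  by (simp add: fac_ratio_def even_fac_Suc odd_fac_Suc)

text \<open>A truncation of the \<open>q\<close>-binomial series for
  \<open>(z q; q^2)_inf / (z; q^2)_inf\<close>.\<close>

definition ratio_sum :: "nat \<Rightarrow> 'a \<Rightarrow> 'a" where
  "ratio_sum N z = (\<Sum>n\<le>N. z ^ n / fac_ratio n)"

text \<open>The full series satisfies \<open>(1 - z) F(z) = (1 - z q) F(q^2 z)\<close>; the last
  term is the error of stopping at \<open>N\<close>.\<close>

lemma ratio_sum_functional:
  "(1 - z) * ratio_sum N z = (1 - z * q) * ratio_sum N (q\<^sup>2 * z) - z ^ Suc N * (1 - q ^ (2 * N + 1)) / fac_ratio N"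
proof (induction N)
  case 0
  show ?case
    by (simp add: ratio_sum_def fac_ratio_def algebra_simps)
next
  case (Suc N)
  have nz: "1 - q ^ (2 * N + 1) \<noteq> 0" "1 - q ^ (2 * N + 2) \<noteq> 0"
    by (rule one_minus_power_nonzero, simp)+
  have f: "(1 - q ^ (2 * N + 1)) / fac_ratio N = (1 - q ^ (2 * N + 2)) / fac_ratio (Suc N)"
    unfolding fac_ratio_Suc using nz by (simp add: field_simps del: one_minus_power_nonzero right_minus_eq)
  have f': "z ^ Suc N * (1 - q ^ (2 * N + 1)) / fac_ratio N = z ^ Suc N * (1 - q ^ (2 * N + 2)) / fac_ratio (Suc N)"
    unfolding times_divide_eq_right[symmetric] f ..
  have p: "(q\<^sup>2 * z) ^ Suc N = q ^ (2 * N + 2) * z ^ Suc N" "q ^ (2 * Suc N + 1) = q * q ^ (2 * N + 2)"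
    by (simp_all add: power_mult_distrib power_mult[symmetric] power2_eq_square mult_2 power_add)
  have "(1 - z) * ratio_sum (Suc N) z - (1 - z * q) * ratio_sum (Suc N) (q\<^sup>2 * z)
     = (1 - z) * ratio_sum N z - (1 - z * q) * ratio_sum N (q\<^sup>2 * z)
       + ((1 - z) * z ^ Suc N - (1 - z * q) * (q ^ (2 * N + 2) * z ^ Suc N)) / fac_ratio (Suc N)"
    unfolding ratio_sum_def sum.atMost_Suc p(1) distrib_left diff_divide_distrib times_divide_eq_right
    by (simp only: algebra_simps)
  also have "\<dots> = (- (z ^ Suc N) * (1 - q ^ (2 * N + 2)) + ((1 - z) * z ^ Suc N - (1 - z * q) * (q ^ (2 * N + 2) * z ^ Suc N))) / fac_ratio (Suc N)"
    unfolding Suc f' by (simp only: add_divide_distrib mult_minus_left minus_divide_left[symmetric]) simp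
  also have "- (z ^ Suc N) * (1 - q ^ (2 * N + 2)) + ((1 - z) * z ^ Suc N - (1 - z * q) * (q ^ (2 * N + 2) * z ^ Suc N))
     = - (z ^ Suc (Suc N) * (1 - q ^ (2 * Suc N + 1)))"
    unfolding p(2) power_Suc[of z "Suc N"] by (simp only: algebra_simps mult_1_left mult_1_right) simp
  finally have "(1 - z) * ratio_sum (Suc N) z - (1 - z * q) * ratio_sum (Suc N) (q\<^sup>2 * z)
     = - (z ^ Suc (Suc N) * (1 - q ^ (2 * Suc N + 1)) / fac_ratio (Suc N))"
    by (simp only: minus_divide_left)
  moreover have "x = y - t" if "x - y = - t" for x y t :: 'a
    using that by (simp add: algebra_simps)
  ultimately show ?case
    by blast
qed

text \<open>
  Shanks' finite form of Gauss's product formula for \<open>\<psi>\<close>: the factor \<open>ratio_sum\<close> is \<open>1\<close> up to terms of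
  order at least \<open>2 n + 1\<close>.
\<close>

lemma shanks: "fac_ratio n * ratio_sum n (q ^ (2 * n + 1)) = (\<Sum>s\<le>2 * n. q ^ tri s)"
proof (induction n)
  case 0
  show ?case
    by (simp add: ratio_sum_def fac_ratio_def)
next
  case (Suc n)
  let ?z = "q ^ (2 * n + 1)" and ?R = "fac_ratio (Suc n)"
  have nz: "1 - ?z \<noteq> 0" "1 - q ^ (2 * n + 2) \<noteq> 0"
    by (rule one_minus_power_nonzero, simp)+
  have z: "q\<^sup>2 * ?z = q ^ (2 * Suc n + 1)" "?z * q = q ^ (2 * n + 2)"
    by (simp_all add: power2_eq_square)
  \<comment> \<open>At \<open>?z\<close> the functional equation passes to the argument belonging to
    \<open>Suc n\<close>, with coefficient \<open>1 - ?z * q = 1 - q ^ (2 * n + 2)\<close>.\<close>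
  have "(1 - q ^ (2 * n + 2)) * (?R * ratio_sum (Suc n) (q ^ (2 * Suc n + 1)))
    = ?R * ((1 - ?z) * ratio_sum (Suc n) ?z) + ?z ^ Suc (Suc n) * (1 - q ^ (2 * Suc n + 1))"
    unfolding ratio_sum_functional z by (simp add: field_simps del: power_Suc)
  also have "ratio_sum (Suc n) ?z = ratio_sum n ?z + ?z ^ Suc n / ?R"
    by (simp add: ratio_sum_def)
  also have "?R * ((1 - ?z) * (ratio_sum n ?z + ?z ^ Suc n / ?R))
     = (1 - q ^ (2 * n + 2)) * (fac_ratio n * ratio_sum n ?z) + (1 - ?z) * ?z ^ Suc n"
  proof -
    have "?R * (1 - ?z) = fac_ratio n * (1 - q ^ (2 * n + 2))"
      unfolding fac_ratio_Suc using nz by (simp del: one_minus_power_nonzero right_minus_eq)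
    moreover have "?R * ((1 - ?z) * (ratio_sum n ?z + ?z ^ Suc n / ?R))
        = ?R * (1 - ?z) * ratio_sum n ?z + (1 - ?z) * ?z ^ Suc n"
      by (simp add: distrib_left mult_ac del: power_Suc)
    ultimately show ?thesis
      by (simp only: mult_ac)
  qed
  finally have *: "(1 - q ^ (2 * n + 2)) * (?R * ratio_sum (Suc n) (q ^ (2 * Suc n + 1)))
    = (1 - q ^ (2 * n + 2)) * (\<Sum>s\<le>2 * n. q ^ tri s)
      + ((1 - ?z) * ?z ^ Suc n + ?z ^ Suc (Suc n) * (1 - q ^ (2 * Suc n + 1)))"
    unfolding Suc by (simp add: algebra_simps)
  have e: "?z ^ Suc n = q ^ tri (2 * n + 1)" "q ^ tri (2 * n + 2) = q ^ tri (2 * n + 1) * q ^ (2 * n + 2)"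
    "?z * q ^ (2 * Suc n + 1) = q ^ (2 * n + 2) * q ^ (2 * n + 2)"
    unfolding power_mult[symmetric] power_add[symmetric] tri_odd
    using tri_Suc[of "2 * n + 1"] tri_odd[of n] by (simp_all add: algebra_simps)
  have "(1 - ?z) * ?z ^ Suc n + ?z ^ Suc (Suc n) * (1 - q ^ (2 * Suc n + 1))
     = ?z ^ Suc n * (1 - ?z * q ^ (2 * Suc n + 1))"
    by (simp add: algebra_simps)
  \<comment> \<open>The subtracted power is the square of \<open>q ^ (2 * n + 2)\<close>; the
    difference of squares yields the two new triangular powers.\<close>
  also have "\<dots> = (1 - q ^ (2 * n + 2)) * (q ^ tri (2 * n + 1) + q ^ tri (2 * n + 2))"
    unfolding e by (simp only: algebra_simps mult_1_left mult_1_right)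
  finally have "(1 - q ^ (2 * n + 2)) * (?R * ratio_sum (Suc n) (q ^ (2 * Suc n + 1)))
    = (1 - q ^ (2 * n + 2)) * ((\<Sum>s\<le>2 * n. q ^ tri s) + (q ^ tri (2 * n + 1) + q ^ tri (2 * n + 2)))"
    unfolding * distrib_left by simp
  then show ?case
    using nz(2) by (simp add: add.assoc del: one_minus_power_nonzero right_minus_eq)
qed

end

section \<open>Sums of three triangular numbers\<close>

text \<open>Divisibility by \<open>fls_X ^ k\<close> among power series. Negative indices are
  included, so \<open>vanishes_below 0\<close> singles out the power series.\<close>

definition vanishes_below :: "nat \<Rightarrow> 'a::field fls \<Rightarrow> bool" where
  "vanishes_below k f \<longleftrightarrow> (\<forall>i < int k. fls_nth f i = 0)"

lemma vanishes_below_iff: "vanishes_below k f \<longleftrightarrow> f = 0 \<or> int k \<le> fls_subdegree f"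
  unfolding vanishes_below_def
  by (metis fls_eq0_below_subdegree fls_subdegree_geI fls_zero_nth order_less_le_trans)

lemma vanishes_below_0 [simp]: "vanishes_below k 0"
  by (simp add: vanishes_below_def)

lemma vanishes_below_add: "vanishes_below k f \<Longrightarrow> vanishes_below k g \<Longrightarrow> vanishes_below k (f + g)"
  by (simp add: vanishes_below_def)

lemma vanishes_below_minus: "vanishes_below k f \<Longrightarrow> vanishes_below k (- f)"
  by (simp add: vanishes_below_def)

lemma vanishes_below_diff: "vanishes_below k f \<Longrightarrow> vanishes_below k g \<Longrightarrow> vanishes_below k (f - g)"
  by (simp add: vanishes_below_def)

lemma vanishes_below_sum: "(\<And>i. i \<in> A \<Longrightarrow> vanishes_below k (f i)) \<Longrightarrow> vanishes_below k (sum f A)"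
  by (induction A rule: infinite_finite_induct) (auto intro: vanishes_below_add)

lemma vanishes_below_mult:
  "vanishes_below k f \<Longrightarrow> vanishes_below l g \<Longrightarrow> vanishes_below (k + l) (f * g)"
  by (cases "f = 0 \<or> g = 0") (auto simp: vanishes_below_iff)

lemma vanishes_below_mono: "vanishes_below k f \<Longrightarrow> l \<le> k \<Longrightarrow> vanishes_below l f"
  by (auto simp: vanishes_below_def)

lemma vanishes_below_X_power: "k \<le> n \<Longrightarrow> vanishes_below k (fls_X ^ n)"
  by (simp add: vanishes_below_def)

text \<open>The invertible power series: multiplying or dividing by one preserves
  \<open>vanishes_below k\<close>.\<close>

definition fls_unit :: "'a::field fls \<Rightarrow> bool" where
  "fls_unit f \<longleftrightarrow> f \<noteq> 0 \<and> fls_subdegree f = 0"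

lemma fls_unit_1 [simp]: "fls_unit 1"
  by (simp add: fls_unit_def)

lemma fls_unit_mult: "fls_unit f \<Longrightarrow> fls_unit g \<Longrightarrow> fls_unit (f * g)"
  by (simp add: fls_unit_def)

lemma fls_unit_divide: "fls_unit f \<Longrightarrow> fls_unit g \<Longrightarrow> fls_unit (f / g)"
  by (simp add: fls_unit_def fls_divide_subdegree)

lemma fls_unit_prod: "(\<And>i. i \<in> A \<Longrightarrow> fls_unit (f i)) \<Longrightarrow> fls_unit (prod f A)"
  by (induction A rule: infinite_finite_induct) (auto intro: fls_unit_mult)

lemma fls_unit_one_minus_X_power: "k > 0 \<Longrightarrow> fls_unit (1 - fls_X ^ k :: 'a::field fls)"
proof -
  assume k: "k > 0"
  have "fls_nth (1 - fls_X ^ k :: 'a fls) 0 \<noteq> 0" "\<And>i. i < 0 \<Longrightarrow> fls_nth (1 - fls_X ^ k :: 'a fls) i = 0"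
    using k by auto
  then show ?thesis
    unfolding fls_unit_def by (metis fls_subdegree_eqI fls_zero_nth)
qed

lemma fls_unit_imp_vanishes_below: "fls_unit f \<Longrightarrow> vanishes_below 0 f"
  by (simp add: fls_unit_def vanishes_below_iff)

lemma vanishes_below_unit_mult: "vanishes_below k f \<Longrightarrow> fls_unit g \<Longrightarrow> vanishes_below k (f * g)"
  using vanishes_below_mult[of k f 0 g] fls_unit_imp_vanishes_below[of g] by simp

lemma vanishes_below_unit_divide: "vanishes_below k f \<Longrightarrow> fls_unit g \<Longrightarrow> vanishes_below k (f / g)"
  using vanishes_below_unit_mult[of k f "1 / g"] fls_unit_divide[of 1 g] by simp

definition fls_nonneg :: "'a::linordered_field fls \<Rightarrow> bool" where
  "fls_nonneg f \<longleftrightarrow> (\<forall>i. fls_nth f i \<ge> 0)"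

lemma fls_nonneg_add: "fls_nonneg f \<Longrightarrow> fls_nonneg g \<Longrightarrow> fls_nonneg (f + g)"
  by (simp add: fls_nonneg_def)

lemma fls_nonneg_sum: "(\<And>i. i \<in> A \<Longrightarrow> fls_nonneg (f i)) \<Longrightarrow> fls_nonneg (sum f A)"
  by (induction A rule: infinite_finite_induct) (auto simp: fls_nonneg_def)

lemma fls_nonneg_mult: "fls_nonneg f \<Longrightarrow> fls_nonneg g \<Longrightarrow> fls_nonneg (f * g)"
  by (simp add: fls_nonneg_def fls_times_nth sum_nonneg)

lemma fls_nonneg_X_power: "fls_nonneg (fls_X ^ n)"
  by (simp add: fls_nonneg_def)

lemma fls_nonneg_1: "fls_nonneg 1"
  using fls_nonneg_X_power[of 0] by simp

text \<open>Compare coefficients in \<open>f = 1 + fls_X ^ k * f\<close>. For \<open>n < k\<close>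
  the shifted index is negative and contributes \<open>0\<close>.\<close>

lemma geometric_nth:
  assumes "k > 0"
  shows "fls_nth (1 / (1 - fls_X ^ k) :: 'a::linordered_field fls) (int n) = (if k dvd n then 1 else 0)"
proof (induction n rule: less_induct)
  case (less n)
  let ?f = "1 / (1 - fls_X ^ k) :: 'a fls"
  have u: "fls_unit (1 - fls_X ^ k :: 'a fls)"
    by (rule fls_unit_one_minus_X_power) fact
  have shift: "fls_nth (fls_X ^ k * g) m = fls_nth g (m - int k)" for g :: "'a fls" and m
    by (simp add: fls_X_power_times_conv_shift)
  have "?f = 1 + fls_X ^ k * ?f"
    using u
    by (simp add: fls_unit_def field_simps)
  then have "fls_nth ?f (int n) = fls_nth (1 + fls_X ^ k * ?f) (int n)"
    by (rule arg_cong[where f = "\<lambda>f. fls_nth f (int n)"])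
  also have "\<dots> = (if n = 0 then 1 else 0) + fls_nth ?f (int n - int k)"
    unfolding fls_plus_nth shift by simp
  finally have f: "fls_nth ?f (int n) = (if n = 0 then 1 else 0) + fls_nth ?f (int n - int k)" .
  have v: "vanishes_below 0 ?f"
    using vanishes_below_unit_divide[OF _ u, of 0 1] vanishes_below_X_power[of 0 0] by simp
  show ?case
  proof (cases "n < k")
    case True
    then show ?thesis
      using f v by (auto simp: vanishes_below_def dest: dvd_imp_le)
  next
    case False
    then have "int n - int k = int (n - k)"
      by simp
    then show ?thesis
      using f False less[of "n - k"] assms by (simp add: dvd_minus_self)
  qed
qed

lemma fls_nonneg_geometric: "k > 0 \<Longrightarrow> fls_nonneg (1 / (1 - fls_X ^ k) :: 'a::linordered_field fls)"
proof -
  assume k: "k > 0"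
  have v: "vanishes_below 0 (1 / (1 - fls_X ^ k) :: 'a fls)"
    using vanishes_below_unit_divide[OF _ fls_unit_one_minus_X_power[OF k], of 0 1]
      vanishes_below_X_power[of 0 0] by simp
  show ?thesis
    unfolding fls_nonneg_def
  proof
    fix i :: int
    show "0 \<le> fls_nth (1 / (1 - fls_X ^ k) :: 'a fls) i"
    proof (cases "i < 0")
      case True
      then show ?thesis
        using v by (simp add: vanishes_below_def)
    next
      case False
      then show ?thesis
        using geometric_nth[OF k, of "nat i", where ?'a = 'a] by simp
    qed
  qed
qed

section \<open>Approximation of \<psi> and its cube\<close>

interpretation X: generic_base "fls_X :: real fls"
proof
  fix k :: nat
  assume "k > 0"
  then show "(fls_X :: real fls) ^ k \<noteq> 1"
    using fls_unit_one_minus_X_power[of k, where ?'a = real] by (auto simp: fls_unit_def)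
qed simp

lemma fls_unit_even_fac: "fls_unit (even_fac fls_X n :: 'a::field fls)"
  unfolding even_fac_def by (intro fls_unit_prod fls_unit_one_minus_X_power) simp

lemma fls_unit_odd_fac: "fls_unit (odd_fac fls_X n :: 'a::field fls)"
  unfolding odd_fac_def by (intro fls_unit_prod fls_unit_one_minus_X_power) simp

lemma fls_unit_fac_ratio: "fls_unit (X.fac_ratio n)"
  unfolding X.fac_ratio_def by (intro fls_unit_divide fls_unit_even_fac fls_unit_odd_fac)

text \<open>Every summand except the first, which is \<open>1\<close>, contains a factor
  \<open>fls_X ^ k\<close>.\<close>

lemma ratio_sum_high_power:
  assumes "m \<le> k"
  shows "vanishes_below m (X.ratio_sum N (fls_X ^ k) - 1)"
proof -
  have "X.ratio_sum N (fls_X ^ k) - 1 = (\<Sum>n<N. (fls_X ^ k) ^ Suc n / X.fac_ratio (Suc n))"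
    unfolding X.ratio_sum_def lessThan_Suc_atMost[symmetric] sum.lessThan_Suc_shift
    by (simp add: X.fac_ratio_def)
  also have "vanishes_below m \<dots>"
    unfolding power_mult[symmetric]
    using assms by (intro vanishes_below_sum vanishes_below_unit_divide vanishes_below_X_power
      fls_unit_fac_ratio) simp
  finally show ?thesis .
qed

text \<open>Apply the functional equation \<open>j\<close> times, starting from
  \<open>z = fls_X\<close>. The coefficients accumulate to \<open>fac_ratio j\<close>, and every
  truncation error contains some \<open>z ^ Suc N\<close>.\<close>

lemma ratio_sum_shift:
  "vanishes_below (Suc N) (X.ratio_sum N fls_X - X.fac_ratio j * X.ratio_sum N (fls_X ^ (2 * j + 1)))"
proof (induction j)
  case 0
  then show ?case
    by (simp add: X.fac_ratio_def)
next
  case (Suc j)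
  let ?X = "fls_X :: real fls"
  let ?z = "?X ^ (2 * j + 1)" and ?e = "?X ^ (2 * j + 2)"
  let ?err = "?z ^ Suc N * (1 - ?X ^ (2 * N + 1)) / X.fac_ratio N"
  have u: "fls_unit (1 - ?z)" "fls_unit (1 - ?X ^ (2 * N + 1))"
    by (rule fls_unit_one_minus_X_power, simp)+
  have z: "?X\<^sup>2 * ?z = ?X ^ (2 * Suc j + 1)" "?z * ?X = ?e"
    by (simp_all add: power2_eq_square)
  have "X.fac_ratio (Suc j) * X.ratio_sum N (?X ^ (2 * Suc j + 1))
    = X.fac_ratio j * ((1 - ?e) * X.ratio_sum N (?X ^ (2 * Suc j + 1))) / (1 - ?z)"
    by (simp add: X.fac_ratio_Suc)
  also have "(1 - ?e) * X.ratio_sum N (?X ^ (2 * Suc j + 1)) = (1 - ?z) * X.ratio_sum N ?z + ?err"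
    using X.ratio_sum_functional[of ?z N] unfolding z by simp
  also have "X.fac_ratio j * ((1 - ?z) * X.ratio_sum N ?z + ?err) / (1 - ?z)
     = X.fac_ratio j * X.ratio_sum N ?z + ?err * X.fac_ratio j / (1 - ?z)"
    using u by (simp add: fls_unit_def field_simps del: X.one_minus_power_nonzero right_minus_eq power_Suc)
  finally have *: "X.fac_ratio (Suc j) * X.ratio_sum N (?X ^ (2 * Suc j + 1))
     = X.fac_ratio j * X.ratio_sum N ?z + ?err * X.fac_ratio j / (1 - ?z)" .
  have "vanishes_below (Suc N) (?err * X.fac_ratio j / (1 - ?z))"
    using u unfolding power_mult[symmetric]
    by (intro vanishes_below_unit_divide vanishes_below_unit_mult vanishes_below_X_power fls_unit_fac_ratio) simp_all
  from vanishes_below_diff[OF Suc this] show ?case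
    unfolding * by (simp add: diff_diff_eq)
qed

definition tri_gen :: "nat \<Rightarrow> real fls" where
  "tri_gen M = (\<Sum>s\<le>M. fls_X ^ tri s)"

lemma fac_ratio_approx: "vanishes_below (Suc N) (X.fac_ratio (Suc N) - tri_gen (2 * Suc N))"
proof -
  have "vanishes_below (Suc N) ((X.ratio_sum (Suc N) (fls_X ^ (2 * Suc N + 1)) - 1) * X.fac_ratio (Suc N))"
    by (intro vanishes_below_unit_mult ratio_sum_high_power fls_unit_fac_ratio) simp
  then show ?thesis
    using X.shanks[of "Suc N"] vanishes_below_minus
    unfolding tri_gen_def by (fastforce simp: algebra_simps)
qed

lemma ratio_sum_approx: "vanishes_below (Suc N) (X.ratio_sum N fls_X - X.fac_ratio (Suc N))"
proof -
  have "vanishes_below (Suc N) ((X.ratio_sum N (fls_X ^ (2 * Suc N + 1)) - 1) * X.fac_ratio (Suc N))"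
    by (intro vanishes_below_unit_mult ratio_sum_high_power fls_unit_fac_ratio) simp
  from vanishes_below_add[OF ratio_sum_shift[of N "Suc N"] this] show ?thesis
    by (simp add: algebra_simps)
qed

text \<open>First \<open>ratio_sum\<close> is replaced by \<open>fac_ratio\<close>, then the cube of
  \<open>fac_ratio\<close> by that of \<open>tri_gen\<close>; the difference of the cubes contains
  the difference of the bases.\<close>

lemma tri_gen_cube_approx:
  "vanishes_below (Suc N) ((X.fac_ratio (Suc N))\<^sup>2 * X.ratio_sum N fls_X - tri_gen (2 * Suc N) ^ 3)"
proof -
  let ?P = "X.fac_ratio (Suc N)" and ?T = "tri_gen (2 * Suc N)"
  have vP: "vanishes_below 0 ?P"
    by (intro fls_unit_imp_vanishes_below fls_unit_fac_ratio)
  have vT: "vanishes_below 0 ?T"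
    unfolding tri_gen_def by (intro vanishes_below_sum vanishes_below_X_power) simp
  have "vanishes_below (Suc N + 0) ((?P - ?T) * (?P * ?P + ?P * ?T + ?T * ?T))"
    using vanishes_below_mult[OF vP vP] vanishes_below_mult[OF vP vT] vanishes_below_mult[OF vT vT]
    by (intro vanishes_below_mult fac_ratio_approx vanishes_below_add) simp_all
  moreover have "vanishes_below (Suc N) ((X.ratio_sum N fls_X - ?P) * (?P * ?P))"
    by (intro vanishes_below_unit_mult ratio_sum_approx fls_unit_mult fls_unit_fac_ratio)
  ultimately have "vanishes_below (Suc N) ((X.ratio_sum N fls_X - ?P) * (?P * ?P) + (?P - ?T) * (?P * ?P + ?P * ?T + ?T * ?T))"
    by (intro vanishes_below_add) simp_all
  also have "(X.ratio_sum N fls_X - ?P) * (?P * ?P) + (?P - ?T) * (?P * ?P + ?P * ?T + ?T * ?T)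
      = ?P\<^sup>2 * X.ratio_sum N fls_X - ?T ^ 3"
    by (simp add: power2_eq_square power3_eq_cube algebra_simps)
  finally show ?thesis .
qed

lemma tri_gen_cube_nth:
  assumes "fls_nth (tri_gen M ^ 3) (int n) \<noteq> 0"
  shows "\<exists>x y z. n = tri x + tri y + tri z"
proof (rule ccontr)
  assume *: "\<not> ?thesis"
  have "tri_gen M ^ 3 = (\<Sum>x\<le>M. \<Sum>y\<le>M. \<Sum>z\<le>M. fls_X ^ (tri z + tri y + tri x))"
    by (simp add: tri_gen_def power3_eq_cube sum_product sum_distrib_left sum_distrib_right power_add)
  moreover have "fls_nth (fls_X ^ (tri z + tri y + tri x) :: real fls) (int n) = 0" for x y z
    using * unfolding fls_X_power_nth by (metis of_nat_eq_iff)
  ultimately show False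
    using assms by (simp add: fls_nth_sum)
qed

section \<open>Order and positivity of Andrews' series\<close>

definition andrews_term :: "nat \<Rightarrow> real fls" where
  "andrews_term r = fls_X ^ (2 * r\<^sup>2 + 2 * r) * X.neg_tri_sum r * (1 + fls_X ^ (2 * r + 1)) / (1 - fls_X ^ (2 * r + 1))"

lemma tri_mono: "m \<le> n \<Longrightarrow> tri m \<le> tri n"
  unfolding tri_def by (intro div_le_mono mult_le_mono) auto

text \<open>Since \<open>tri j \<le> tri (2 * r) = 2 * r^2 + r\<close>, the prefactor absorbs all
  negative powers with at least \<open>r\<close> to spare.\<close>

lemma andrews_numerator:
  "fls_X ^ (2 * r\<^sup>2 + 2 * r) * X.neg_tri_sum r = (\<Sum>j\<le>2 * r. fls_X ^ (2 * r\<^sup>2 + 2 * r - tri j))"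
  "j \<le> 2 * r \<Longrightarrow> r \<le> 2 * r\<^sup>2 + 2 * r - tri j"
proof -
  have t: "tri j + r \<le> 2 * r\<^sup>2 + 2 * r" if "j \<le> 2 * r" for j
    using tri_mono[OF that] tri_even[of r] by (simp add: power2_eq_square algebra_simps)
  then show "j \<le> 2 * r \<Longrightarrow> r \<le> 2 * r\<^sup>2 + 2 * r - tri j"
    by fastforce
  show "fls_X ^ (2 * r\<^sup>2 + 2 * r) * X.neg_tri_sum r = (\<Sum>j\<le>2 * r. fls_X ^ (2 * r\<^sup>2 + 2 * r - tri j))"
    unfolding X.neg_tri_sum_def sum_distrib_left
  proof (rule sum.cong)
    fix j assume "j \<in> {..2 * r}"
    then have "tri j \<le> 2 * r\<^sup>2 + 2 * r"
      using t[of j] by simp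
    then show "fls_X ^ (2 * r\<^sup>2 + 2 * r) * (1 / fls_X ^ tri j) = (fls_X ^ (2 * r\<^sup>2 + 2 * r - tri j) :: real fls)"
      by (simp only: power_diff[OF fls_X_nonzero] times_divide_eq_right mult_1_right)
  qed simp
qed

lemma fls_nonneg_andrews_term: "fls_nonneg (andrews_term r)"
proof -
  have "andrews_term r = (\<Sum>j\<le>2 * r. fls_X ^ (2 * r\<^sup>2 + 2 * r - tri j)) * (1 + fls_X ^ (2 * r + 1)) * (1 / (1 - fls_X ^ (2 * r + 1)))"
    unfolding andrews_term_def andrews_numerator(1) by simp
  also have "fls_nonneg \<dots>"
    by (intro fls_nonneg_mult fls_nonneg_sum fls_nonneg_add fls_nonneg_1 fls_nonneg_X_power
      fls_nonneg_geometric) simp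
  finally show ?thesis .
qed

lemma vanishes_below_andrews_term: "vanishes_below r (andrews_term r)"
proof -
  have "vanishes_below r (\<Sum>j\<le>2 * r. fls_X ^ (2 * r\<^sup>2 + 2 * r - tri j) :: real fls)"
    by (intro vanishes_below_sum vanishes_below_X_power andrews_numerator(2)) simp
  moreover have "vanishes_below 0 (1 + fls_X ^ (2 * r + 1) :: real fls)"
    using vanishes_below_add[OF vanishes_below_X_power[of 0 0] vanishes_below_X_power[of 0 "2 * r + 1"]] by simp
  ultimately have "vanishes_below (r + 0) ((\<Sum>j\<le>2 * r. fls_X ^ (2 * r\<^sup>2 + 2 * r - tri j) :: real fls) * (1 + fls_X ^ (2 * r + 1)))"
    by (rule vanishes_below_mult)
  then show ?thesis
    unfolding andrews_term_def andrews_numerator(1) add_0_right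
    by (intro vanishes_below_unit_divide fls_unit_one_minus_X_power) simp_all
qed

text \<open>At \<open>r = 0\<close> the quotient is exactly \<open>1 - fls_X ^ (2 * N + 2)\<close>.
  Passing to \<open>Suc r\<close> multiplies it by \<open>(1 - ?x) / (1 - ?y)\<close>, which is
  \<open>1\<close> up to order \<open>2 * (N - r)\<close>, the precision claimed for
  \<open>Suc r\<close>.\<close>

lemma andrews_factor_approx:
  assumes "r \<le> N"
  shows "vanishes_below (2 * (N - r) + 2) ((even_fac fls_X (Suc N))\<^sup>2 / (even_fac fls_X (N - r) * even_fac fls_X (N + r + 1)) - 1 :: real fls)"
  using assms
proof (induction r)
  case 0
  have "even_fac fls_X N \<noteq> (0 :: real fls)" "even_fac fls_X (Suc N) \<noteq> (0 :: real fls)"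
    by (rule X.even_fac_nonzero)+
  then have "(even_fac fls_X (Suc N))\<^sup>2 / (even_fac fls_X N * even_fac fls_X (Suc N)) - 1 = - (fls_X ^ (2 * N + 2) :: real fls)"
    by (simp add: even_fac_Suc power2_eq_square del: power_Suc)
  then show ?case
    using vanishes_below_minus[OF vanishes_below_X_power[of "2 * N + 2" "2 * N + 2"]] by simp
next
  case (Suc r)
  let ?X = "fls_X :: real fls"
  let ?E = "\<lambda>r. (even_fac ?X (Suc N))\<^sup>2 / (even_fac ?X (N - r) * even_fac ?X (N + r + 1))"
  obtain d where d: "N = Suc r + d"
    using Suc.prems le_Suc_ex by blast
  let ?x = "?X ^ (2 * d + 2)" and ?y = "?X ^ (2 * (N + r + 1) + 2)"
  have u: "fls_unit (1 - ?x)" "fls_unit (1 - ?y)"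
    by (rule fls_unit_one_minus_X_power, simp)+
  have e: "even_fac ?X (N - r) = even_fac ?X (N - Suc r) * (1 - ?x)"
    "even_fac ?X (N + Suc r + 1) = even_fac ?X (N + r + 1) * (1 - ?y)"
    using even_fac_Suc[of ?X d] even_fac_Suc[of ?X "N + r + 1"] by (simp_all add: d)
  have "?E (Suc r) = ?E r * (1 - ?x) / (1 - ?y)"
    unfolding e using u by (simp add: fls_unit_def del: X.one_minus_power_nonzero right_minus_eq power_Suc)
  then have "?E (Suc r) - 1 = ((?E r - 1) * (1 - ?x) + (?y - ?x)) / (1 - ?y)"
    using u by (simp add: fls_unit_def field_simps del: X.one_minus_power_nonzero right_minus_eq power_Suc)
  moreover have "vanishes_below (2 * d + 2) (?E r - 1)"
    by (rule vanishes_below_mono[OF Suc.IH]) (simp_all add: d)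
  then have "vanishes_below (2 * d + 2) (((?E r - 1) * (1 - ?x) + (?y - ?x)) / (1 - ?y))"
    using u by (intro vanishes_below_unit_divide vanishes_below_add[OF vanishes_below_unit_mult]
      vanishes_below_diff[OF vanishes_below_X_power vanishes_below_X_power]) (simp_all add: d)
  ultimately show ?case
    by (simp only: d add_diff_cancel_left')
qed

lemma sum_of_three_triangular:
  fixes n :: nat
  shows "\<exists>x y z. n = tri x + tri y + tri z"
proof -
  let ?E = "\<lambda>r. (even_fac fls_X (Suc n))\<^sup>2 / (even_fac fls_X (n - r) * even_fac fls_X (n + r + 1)) :: real fls"
  let ?G = "(X.fac_ratio (Suc n))\<^sup>2 * X.ratio_sum n fls_X"
  have "?G = (\<Sum>r\<le>n. andrews_term r * ?E r)"
    unfolding X.ratio_sum_def X.andrews_finite andrews_term_def ..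
  moreover have "fls_nth (andrews_term r * ?E r) (int n) = fls_nth (andrews_term r) (int n)" if "r \<le> n" for r
  proof -
    \<comment> \<open>This order exceeds \<open>n\<close>, so replacing the factor
      \<open>?E r\<close> by \<open>1\<close> leaves the coefficient at \<open>n\<close>
      unchanged.\<close>
    have "vanishes_below (r + (2 * (n - r) + 2)) (andrews_term r * (?E r - 1))"
      by (intro vanishes_below_mult vanishes_below_andrews_term andrews_factor_approx that)
    then have "fls_nth (andrews_term r * (?E r - 1)) (int n) = 0"
      using that by (simp add: vanishes_below_def)
    then show ?thesis
      by (simp add: right_diff_distrib)
  qed
  ultimately have "fls_nth ?G (int n) = (\<Sum>r\<le>n. fls_nth (andrews_term r) (int n))"
    by (simp add: fls_nth_sum)
  moreover have "\<dots> \<ge> fls_nth (andrews_term 0) (int n)"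
    using fls_nonneg_andrews_term by (intro member_le_sum) (auto simp: fls_nonneg_def)
  \<comment> \<open>The geometric series alone contributes \<open>1\<close> to every coefficient of
    \<open>(1 + q) / (1 - q)\<close>.\<close>
  moreover have "fls_nth (andrews_term 0) (int n) > 0"
  proof -
    have "andrews_term 0 = 1 / (1 - fls_X ^ 1) + fls_X ^ 1 * (1 / (1 - fls_X ^ 1))"
      by (simp add: andrews_term_def X.neg_tri_sum_def add_divide_distrib)
    moreover have "fls_nonneg (fls_X ^ 1 * (1 / (1 - fls_X ^ 1)) :: real fls)"
      by (intro fls_nonneg_mult fls_nonneg_X_power fls_nonneg_geometric) simp
    ultimately show ?thesis
      using geometric_nth[of 1 n, where ?'a = real] by (simp add: fls_nonneg_def add_pos_nonneg del: power_one_right)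
  qed
  moreover have "fls_nth (tri_gen (2 * Suc n) ^ 3) (int n) = fls_nth ?G (int n)"
    using tri_gen_cube_approx[of n] by (simp add: vanishes_below_def)
  ultimately have "fls_nth (tri_gen (2 * Suc n) ^ 3) (int n) \<noteq> 0"
    by linarith
  then show ?thesis
    by (rule tri_gen_cube_nth)
qed

section \<open>Cauchy's lemma and sums of four polygonal numbers\<close>

text \<open>Represent \<open>(n - 3) / 8\<close> by three triangular numbers and use
  \<open>(2 * x + 1)^2 = 8 * tri x + 1\<close>.\<close>

lemma sum_of_three_odd_squares:
  fixes n :: int
  assumes "n mod 8 = 3" and "n > 0"
  shows "\<exists>x y z :: int. odd x \<and> odd y \<and> odd z \<and> x\<^sup>2 + y\<^sup>2 + z\<^sup>2 = n"
proof -
  have n: "n = 8 * int (nat (n div 8)) + 3"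
    using assms mult_div_mod_eq[of 8 n] by simp
  obtain x y z where "nat (n div 8) = tri x + tri y + tri z"
    using sum_of_three_triangular by blast
  then have "8 * int (nat (n div 8)) = 4 * int (2 * tri x) + 4 * int (2 * tri y) + 4 * int (2 * tri z)"
    by simp
  then have "(2 * int x + 1)\<^sup>2 + (2 * int y + 1)\<^sup>2 + (2 * int z + 1)\<^sup>2 = n"
    using n unfolding two_tri by (simp add: power2_eq_square algebra_simps)
  then show ?thesis
    by (metis odd_two_times_div_two_succ even_add even_mult_iff even_numeral odd_one)
qed

text \<open>Write \<open>4 * S - T^2\<close> as \<open>x^2 + y^2 + z^2\<close> with odd terms. The
  four numbers are \<open>(T + x + y + z) / 4\<close> and \<open>(T + x - y - z) / 4\<close> with
  its two permutations: \<open>up\<close> makes the three-square theorem applicable, and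
  \<open>low\<close> makes the four numbers nonnegative.\<close>

lemma cauchy_lemma:
  fixes S T :: int
  assumes "odd S" "odd T" and T: "T \<ge> 0" and up: "T\<^sup>2 < 4 * S" and low: "3 * S < T\<^sup>2 + 2 * T + 4"
  shows "\<exists>w x y z :: nat. S = (int w)\<^sup>2 + (int x)\<^sup>2 + (int y)\<^sup>2 + (int z)\<^sup>2
    \<and> T = int w + int x + int y + int z"
proof -
  obtain s t where st: "S = 2 * s + 1" "T = 2 * t + 1"
    using assms(1,2) by (auto elim!: oddE)
  have "even (t * (t + 1))"
    by simp
  then obtain v where v: "t * (t + 1) = 2 * v"
    by (rule evenE)
  have "4 * S - T\<^sup>2 = 8 * (s - v) + 3"
    using v unfolding st by (simp add: power2_eq_square algebra_simps)
  then have "(4 * S - T\<^sup>2) mod 8 = 3"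
    by presburger
  then obtain x y z0 where odd: "odd x" "odd y" "odd z0" and xyz0: "x\<^sup>2 + y\<^sup>2 + z0\<^sup>2 = 4 * S - T\<^sup>2"
    using sum_of_three_odd_squares[of "4 * S - T\<^sup>2"] up by auto
  \<comment> \<open>Changing the sign of \<open>z0\<close> changes the even sum by
    \<open>2 * z0\<close>, which is \<open>2\<close> modulo \<open>4\<close>, so one of the signs
    works.\<close>
  obtain z where z: "z = z0 \<or> z = - z0" and "4 dvd T + x + y + z"
  proof -
    have "4 dvd T + x + y + z0 \<or> 4 dvd T + x + y + - z0"
      using odd \<open>odd T\<close> by presburger
    then show ?thesis
      using that by blast
  qed
  then obtain d where d: "T + x + y + z = 4 * d"
    by blast
  have oz: "odd z"
    using z odd by auto
  have xyz: "x\<^sup>2 + y\<^sup>2 + z\<^sup>2 = 4 * S - T\<^sup>2"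
    using xyz0 z by auto
  obtain d1 d2 d3 where d123: "T + x = 2 * (d + d1)" "T + y = 2 * (d + d2)" "T + z = 2 * (d + d3)"
  proof -
    have "\<exists>e. T + u = 2 * (d + e)" if "odd u" for u
      using that \<open>odd T\<close> by presburger
    then show ?thesis
      using that odd oz by meson
  qed
  have T_eq: "T = d + d1 + d2 + d3"
    using d d123 by presburger
  have x_eq: "x = d + d1 - d2 - d3" "y = d + d2 - d1 - d3" "z = d + d3 - d1 - d2"
    using d123 unfolding T_eq by (simp_all add: algebra_simps)
  have "4 * S = 4 * (d\<^sup>2 + d1\<^sup>2 + d2\<^sup>2 + d3\<^sup>2)"
    using xyz unfolding x_eq T_eq by (simp add: power2_eq_square algebra_simps)
  then have S_eq: "S = d\<^sup>2 + d1\<^sup>2 + d2\<^sup>2 + d3\<^sup>2"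
    by simp
  have "(\<bar>x\<bar> + \<bar>y\<bar> + \<bar>z\<bar>)\<^sup>2 \<le> 3 * (x\<^sup>2 + y\<^sup>2 + z\<^sup>2)"
  proof -
    have "3 * (x\<^sup>2 + y\<^sup>2 + z\<^sup>2) - (\<bar>x\<bar> + \<bar>y\<bar> + \<bar>z\<bar>)\<^sup>2
        = (\<bar>x\<bar> - \<bar>y\<bar>)\<^sup>2 + (\<bar>y\<bar> - \<bar>z\<bar>)\<^sup>2 + (\<bar>x\<bar> - \<bar>z\<bar>)\<^sup>2"
      unfolding power2_abs[of x, symmetric] power2_abs[of y, symmetric] power2_abs[of z, symmetric]
      by (simp add: power2_eq_square algebra_simps)
    moreover have "\<dots> \<ge> 0"
      by simp
    ultimately show ?thesis
      by linarith
  qed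
  also have "\<dots> < (T + 4)\<^sup>2"
    unfolding xyz using low by (simp add: power2_eq_square algebra_simps)
  \<comment> \<open>Hence four times each of the integers \<open>d\<close>, \<open>d1\<close>,
    \<open>d2\<close>, \<open>d3\<close> exceeds \<open>-4\<close>.\<close>
  finally have "\<bar>x\<bar> + \<bar>y\<bar> + \<bar>z\<bar> < T + 4"
    using T by (simp add: power2_less_imp_less)
  then have "d \<ge> 0" "d1 \<ge> 0" "d2 \<ge> 0" "d3 \<ge> 0"
    using x_eq T_eq by linarith+
  then show ?thesis
    using S_eq T_eq by (intro exI[of _ "nat d"] exI[of _ "nat d1"] exI[of _ "nat d2"] exI[of _ "nat d3"]) simp
qed

text \<open>
  Here \<open>(y - (2 a + 3 b)) / (2 a)\<close> and \<open>(sqrt (4 b\<^sup>2 + 8 a n) - 2 b) / a\<close> are the endpoints of the interval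
  for \<open>T\<close>. Squaring twice turns the claim on its length into the bound on \<open>n\<close>.
\<close>

lemma window_length:
  fixes a b n :: real
  defines "y \<equiv> sqrt (24 * a * n + 9 * b\<^sup>2 + 12 * a * b - 12 * a\<^sup>2)"
  assumes a: "a \<ge> 1" and b: "b \<ge> 1 - a"
    and n: "n > 2 * a * (7 * a * (a - 1) + 1) + (7 * a - 2) * b
      + (2 * a * (2 * a - 1) + b) * sqrt (6 * (2 * a * (a - 1) + b))"
  shows "4 * a\<^sup>2 - 2 * a + b + y < 2 * sqrt (4 * b\<^sup>2 + 8 * a * n)"
    and "n > a"
proof -
  \<comment> \<open>The hypothesis becomes \<open>n > K + C * R\<close>, and the first claim
    \<open>C + y < 2 * sqrt (4 * b^2 + 8 * a * n)\<close>.\<close>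
  define D where "D = 2 * a * (a - 1) + b"
  define C where "C = 2 * a * (2 * a - 1) + b"
  define R where "R = sqrt (6 * D)"
  define K where "K = 2 * a * (7 * a * (a - 1) + 1) + (7 * a - 2) * b"
  have "D \<ge> (2 * a - 1) * (a - 1)"
    using b by (simp add: D_def algebra_simps)
  moreover have "(2 * a - 1) * (a - 1) \<ge> 0"
    using a by simp
  ultimately have D: "D \<ge> 0"
    by linarith
  then have R: "R \<ge> 0" "R\<^sup>2 = 6 * D"
    by (simp_all add: R_def)
  have C: "C \<ge> 0"
  proof -
    have "C = D + 2 * a\<^sup>2"
      by (simp add: C_def D_def power2_eq_square algebra_simps)
    then show ?thesis
      using D by simp
  qed
  have n': "n > K + C * R"
    using n by (simp add: K_def C_def R_def D_def)
  have "K \<ge> 2 * a * (7 * a * (a - 1) + 1) + (7 * a - 2) * (1 - a)"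
    unfolding K_def using a b by (intro add_left_mono mult_left_mono) auto
  moreover have "2 * a * (7 * a * (a - 1) + 1) + (7 * a - 2) * (1 - a) - a
      = 14 * a * (a - 1)\<^sup>2 + (a - 1) * (7 * a + 3) + 1"
    by (simp add: power2_eq_square algebra_simps)
  moreover have "14 * a * (a - 1)\<^sup>2 \<ge> 0" "(a - 1) * (7 * a + 3) \<ge> 0" "C * R \<ge> 0"
    using a C R by simp_all
  ultimately show "n > a"
    using n' by linarith
  have "24 * a * n > 24 * a * (K + C * R)"
    using n' a by simp
  \<comment> \<open>So \<open>3 * C + 4 * a * R\<close> is the value of \<open>y\<close> at the
    threshold \<open>n = K + C * R\<close>.\<close>
  moreover have "(3 * C + 4 * a * R)\<^sup>2 = 24 * a * (K + C * R) + 9 * b\<^sup>2 + 12 * a * b - 12 * a\<^sup>2"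
  proof -
    have "(3 * C + 4 * a * R)\<^sup>2 = 9 * C\<^sup>2 + 24 * a * (C * R) + 16 * a\<^sup>2 * R\<^sup>2"
      by (simp add: power2_eq_square algebra_simps)
    also have "\<dots> = 24 * a * (K + C * R) + 9 * b\<^sup>2 + 12 * a * b - 12 * a\<^sup>2"
      unfolding R(2) unfolding C_def D_def K_def by (simp add: power2_eq_square algebra_simps)
    finally show ?thesis .
  qed
  ultimately have Y: "24 * a * n + 9 * b\<^sup>2 + 12 * a * b - 12 * a\<^sup>2 > (3 * C + 4 * a * R)\<^sup>2"
    by linarith
  then have y2: "y\<^sup>2 = 24 * a * n + 9 * b\<^sup>2 + 12 * a * b - 12 * a\<^sup>2"
    unfolding y_def by (intro real_sqrt_pow2) (smt (verit) zero_le_power2)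
  have "y > 3 * C + 4 * a * R"
    unfolding y_def using Y by (rule real_less_rsqrt)
  then have "(y - 3 * C)\<^sup>2 > (4 * a * R)\<^sup>2"
    using a R by (intro power_strict_mono) auto
  \<comment> \<open>A difference of squares: \<open>C - (b - 2 * a) = 4 * a^2\<close> and
    \<open>C + (b - 2 * a) = 2 * D\<close>.\<close>
  also have "(4 * a * R)\<^sup>2 = 12 * (C\<^sup>2 - (b - 2 * a)\<^sup>2)"
    unfolding power_mult_distrib R(2) by (simp add: C_def D_def power2_eq_square algebra_simps)
  finally have "(C + y)\<^sup>2 < 4 * y\<^sup>2 / 3 + 4 * (b - 2 * a)\<^sup>2"
    by (simp add: power2_eq_square field_simps)
  also have "\<dots> = 4 * (4 * b\<^sup>2 + 8 * a * n)"
    unfolding y2 by (simp add: power2_eq_square field_simps)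
  finally have "C + y < sqrt (4 * (4 * b\<^sup>2 + 8 * a * n))"
    by (rule real_less_rsqrt)
  then show "4 * a\<^sup>2 - 2 * a + b + y < 2 * sqrt (4 * b\<^sup>2 + 8 * a * n)"
    unfolding real_sqrt_mult by (simp add: C_def power2_eq_square algebra_simps)
qed

section \<open>The choice of \<open>T\<close> and the representation\<close>

text \<open>With \<open>a * S = 2 * n - b * T\<close>, the inequalities are those of Cauchy's lemma
  times \<open>a\<close>. The first \<open>T\<close> of the class above the lower endpoint
  \<open>L\<close> is at most \<open>L + 2 * a\<close>, which \<open>window_length\<close> puts
  below the upper endpoint.\<close>

lemma exists_in_window:
  fixes a b n :: real and r :: int
  assumes a: "a \<ge> 1" and b: "b \<ge> 1 - a"
    and n: "n > 2 * a * (7 * a * (a - 1) + 1) + (7 * a - 2) * b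
      + (2 * a * (2 * a - 1) + b) * sqrt (6 * (2 * a * (a - 1) + b))"
  shows "\<exists>k :: int. let T = of_int r + 2 * a * of_int k in T \<ge> 0 \<and>
      a * T\<^sup>2 < 4 * (2 * n - b * T) \<and> 3 * (2 * n - b * T) < a * (T\<^sup>2 + 2 * T + 4)"
proof -
  define y where "y = sqrt (24 * a * n + 9 * b\<^sup>2 + 12 * a * b - 12 * a\<^sup>2)"
  define u where "u = sqrt (4 * b\<^sup>2 + 8 * a * n)"
  define L where "L = (y - (2 * a + 3 * b)) / (2 * a)"
  \<comment> \<open>Adding \<open>1\<close> to the floor keeps \<open>T > L\<close> strict even if
    \<open>L\<close> lies in the class.\<close>
  define k where "k = \<lfloor>(L - of_int r) / (2 * a)\<rfloor> + 1"
  define T where "T = of_int r + 2 * a * of_int k"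
  have len: "4 * a\<^sup>2 - 2 * a + b + y < 2 * u" and na: "n > a"
    using window_length[OF assms] by (simp_all add: y_def u_def)
  have an: "a * n \<ge> 0"
    using na a by simp
  have Y: "24 * a * n + 9 * b\<^sup>2 + 12 * a * b - 12 * a\<^sup>2 = (2 * a + 3 * b)\<^sup>2 + 4 * a * (6 * n - 4 * a)"
    by (simp add: power2_eq_square algebra_simps)
  have Y': "4 * a * (6 * n - 4 * a) \<ge> 0"
    using na a by simp
  have y: "y \<ge> 0" "y\<^sup>2 = (2 * a + 3 * b)\<^sup>2 + 4 * a * (6 * n - 4 * a)"
    unfolding y_def Y using Y' by simp_all
  have "\<bar>2 * a + 3 * b\<bar> \<le> y"
    unfolding y_def Y using Y' by (intro real_le_rsqrt) simp
  then have L0: "L \<ge> 0"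
    using a by (simp add: L_def)
  have k: "of_int k > (L - of_int r) / (2 * a)" "of_int k \<le> (L - of_int r) / (2 * a) + 1"
    unfolding k_def by linarith+
  have TL: "T > L"
    using k(1) a by (simp add: T_def field_simps)
  have "T \<le> L + 2 * a"
    using k(2) a by (simp add: T_def field_simps)
  then have "2 * a * T \<le> 2 * a * (L + 2 * a)"
    using a by simp
  also have "\<dots> = y - (2 * a + 3 * b) + 4 * a\<^sup>2"
    using a by (simp add: L_def power2_eq_square field_simps)
  finally have TU: "a * T + 2 * b < u"
    using len by linarith
  have u: "u\<^sup>2 = 4 * b\<^sup>2 + 8 * a * n" "u \<ge> 0"
    unfolding u_def using an by simp_all
  \<comment> \<open>As \<open>b\<close> may be negative, squaring also needs
    \<open>a * T + 2 * b > - u\<close>.\<close>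
  have "\<bar>2 * b\<bar> \<le> u"
    unfolding u_def using an by (intro real_le_rsqrt) (simp add: power_mult_distrib)
  moreover have "a * T \<ge> 0" "a * T > 0"
    using TL L0 a by simp_all
  ultimately have "\<bar>a * T + 2 * b\<bar> < u"
    using TU by linarith
  then have "(a * T + 2 * b)\<^sup>2 < u\<^sup>2"
    using power_strict_mono[of "\<bar>a * T + 2 * b\<bar>" u 2] by simp
  then have "a * (a * T\<^sup>2) < a * (4 * (2 * n - b * T))"
    unfolding u by (simp add: power2_eq_square algebra_simps)
  then have 1: "a * T\<^sup>2 < 4 * (2 * n - b * T)"
    using a by simp
  have "y < 2 * a * T + (2 * a + 3 * b)"
    using TL a by (simp add: L_def field_simps)
  then have "y\<^sup>2 < (2 * a * T + (2 * a + 3 * b))\<^sup>2"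
    using y(1) by (intro power_strict_mono) auto
  then have "4 * a * (3 * (2 * n - b * T)) < 4 * a * (a * (T\<^sup>2 + 2 * T + 4))"
    unfolding y(2) by (simp add: power2_eq_square algebra_simps)
  then have 2: "3 * (2 * n - b * T) < a * (T\<^sup>2 + 2 * T + 4)"
    using a by simp
  show ?thesis
    using 1 2 TL L0 by (intro exI[of _ k]) (auto simp: Let_def T_def)
qed

lemma four_polygonal_int:
  fixes a b n :: int
  assumes a: "a > 0" and "b > - a" and "odd a" and "odd b" and "coprime a b"
    and n: "real_of_int n > of_int (2 * a * (7 * a * (a - 1) + 1) + (7 * a - 2) * b)
                + of_int (2 * a * (2 * a - 1) + b) * sqrt (of_int (6 * (2 * a * (a - 1) + b)))"
  shows "\<exists>w x y z :: nat. 2 * n = int w * (a * int w + b) + int x * (a * int x + b)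
     + int y * (a * int y + b) + int z * (a * int z + b)"
proof -
  obtain u v where uv: "u * a + v * b = 1"
    using bezout_int[of a b] \<open>coprime a b\<close> by auto
  \<comment> \<open>Modulo \<open>a\<close>, \<open>v\<close> inverts \<open>b\<close>, so
    \<open>T\<close> congruent to \<open>2 * n * v\<close> gives \<open>a dvd 2 * n - b * T\<close>.
    Adding the odd \<open>a\<close> changes parity, so the class has odd members, and steps of
    \<open>2 * a\<close> keep them odd.\<close>
  define r where "r = (if odd (2 * n * v) then 2 * n * v else 2 * n * v + a)"
  have r: "odd r"
    using \<open>odd a\<close> by (auto simp: r_def)
  have ab: "real_of_int a \<ge> 1" "real_of_int b \<ge> 1 - real_of_int a"
    using a \<open>b > - a\<close> by linarith+
  have n': "real_of_int n > 2 * real_of_int a * (7 * real_of_int a * (real_of_int a - 1) + 1)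
      + (7 * real_of_int a - 2) * real_of_int b + (2 * real_of_int a * (2 * real_of_int a - 1) + real_of_int b)
        * sqrt (6 * (2 * real_of_int a * (real_of_int a - 1) + real_of_int b))"
    using n by simp
  obtain k where k: "let T = real_of_int r + 2 * real_of_int a * of_int k in T \<ge> 0 \<and>
      real_of_int a * T\<^sup>2 < 4 * (2 * real_of_int n - real_of_int b * T)
      \<and> 3 * (2 * real_of_int n - real_of_int b * T) < real_of_int a * (T\<^sup>2 + 2 * T + 4)"
    using exists_in_window[OF ab n', of r] by (rule exE)
  define T where "T = r + 2 * a * k"
  have T_real: "real_of_int r + 2 * real_of_int a * of_int k = real_of_int T"
    by (simp add: T_def)
  have "real_of_int 0 \<le> of_int T" "real_of_int (a * T\<^sup>2) < of_int (4 * (2 * n - b * T))"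
    "real_of_int (3 * (2 * n - b * T)) < of_int (a * (T\<^sup>2 + 2 * T + 4))"
    using k unfolding T_real Let_def by simp_all
  then have T: "T \<ge> 0" "a * T\<^sup>2 < 4 * (2 * n - b * T)" "3 * (2 * n - b * T) < a * (T\<^sup>2 + 2 * T + 4)"
    unfolding of_int_le_iff of_int_less_iff by blast+
  have "a dvd 2 * n - b * T"
  proof -
    have "2 * n - b * (2 * n * v) = 2 * n * (u * a + v * b) - b * (2 * n * v)"
      using uv by simp
    also have "\<dots> = a * (2 * n * u)"
      by (simp add: algebra_simps)
    finally have "2 * n - b * (2 * n * v) = a * (2 * n * u)" .
    moreover obtain e where "T = 2 * n * v + a * e"
    proof
      show "T = 2 * n * v + a * ((if odd (2 * n * v) then 0 else 1) + 2 * k)"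
        by (simp add: T_def r_def algebra_simps)
    qed
    ultimately have "2 * n - b * T = a * (2 * n * u) - a * (b * e)"
      by (simp only: distrib_left mult.left_commute[of b a])
    then show ?thesis
      by simp
  qed
  then obtain S where S: "2 * n - b * T = a * S"
    by blast
  have "odd T"
    using r by (simp add: T_def)
  moreover have "odd S"
  proof -
    have "even (a * S + b * T)"
      using S by (metis diff_add_cancel dvd_triv_left)
    then show ?thesis
      using \<open>odd a\<close> \<open>odd b\<close> \<open>odd T\<close> by simp
  qed
  moreover have "a * T\<^sup>2 < a * (4 * S)" "a * (3 * S) < a * (T\<^sup>2 + 2 * T + 4)"
    using T(2,3) unfolding S by (simp_all add: algebra_simps)
  then have "T\<^sup>2 < 4 * S" "3 * S < T\<^sup>2 + 2 * T + 4"
    using a by simp_all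
  ultimately obtain w x y z :: nat where
    "S = (int w)\<^sup>2 + (int x)\<^sup>2 + (int y)\<^sup>2 + (int z)\<^sup>2" "T = int w + int x + int y + int z"
    using cauchy_lemma T(1) by blast
  moreover have "2 * n = a * S + b * T"
    using S by simp
  ultimately show ?thesis
    by (intro exI[of _ w] exI[of _ x] exI[of _ y] exI[of _ z])
      (simp add: power2_eq_square algebra_simps)
qed

theorem theorem1:
  fixes a b :: int
  assumes "a > 0" and "b > - a" and "odd a" and "odd b" and "gcd a b = 1"
  shows "asymptotic_base 4 {real x * (of_int a * real x + of_int b) / 2 | x :: nat. True} \<and>
    (\<forall>n :: nat.
       real n > of_int (2 * a * (7 * a * (a - 1) + 1) + (7 * a - 2) * b)
                + of_int (2 * a * (2 * a - 1) + b) * sqrt (of_int (6 * (2 * a * (a - 1) + b)))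
       \<longrightarrow> (\<exists>w x y z :: nat.
             real n = real w * (of_int a * real w + of_int b) / 2
                    + real x * (of_int a * real x + of_int b) / 2
                    + real y * (of_int a * real y + of_int b) / 2
                    + real z * (of_int a * real z + of_int b) / 2))"
    (is "asymptotic_base 4 ?A \<and> (\<forall>n :: nat. real n > ?K \<longrightarrow> ?R n)")
proof -
  let ?f = "\<lambda>x :: nat. real x * (of_int a * real x + of_int b) / 2"
  have rep: "?R n" if n: "real n > ?K" for n :: nat
  proof -
    obtain w x y z :: nat where "2 * int n = int w * (a * int w + b) + int x * (a * int x + b)
        + int y * (a * int y + b) + int z * (a * int z + b)"
      using four_polygonal_int[of a b "int n"] assms n by (auto simp: coprime_iff_gcd_eq_1)
    then have "real_of_int (2 * int n) = real_of_int (int w * (a * int w + b) + int x * (a * int x + b)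
        + int y * (a * int y + b) + int z * (a * int z + b))"
      by simp
    then have "real n = ?f w + ?f x + ?f y + ?f z"
      by simp
    then show ?thesis
      by blast
  qed
  have "?A \<subseteq> \<nat>"
  proof
    fix t assume "t \<in> ?A"
    then obtain x :: nat where x: "t = ?f x"
      by blast
    \<comment> \<open>For odd \<open>x\<close>, the second factor is a sum of two odd
      numbers.\<close>
    have "even (int x * (a * int x + b))"
      using assms by simp
    then obtain m where m: "int x * (a * int x + b) = 2 * m"
      by blast
    have "int x * (a * int x + b) \<ge> 0"
    proof (cases "x = 0")
      case False
      \<comment> \<open>Although \<open>b\<close> may be negative,
        \<open>a * x + b \<ge> a + b > 0\<close> for positive \<open>x\<close>.\<close>
      then have "a * int x \<ge> a * 1"
        using assms by (intro mult_left_mono) auto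
      then have "a * int x + b \<ge> 0"
        using assms(2) by linarith
      then show ?thesis
        by simp
    qed simp
    with m have "m \<ge> 0"
      by simp
    have "real_of_int (int x * (a * int x + b)) = real_of_int (2 * m)"
      using m by (rule arg_cong)
    then have "t = real (nat m)"
      using x \<open>m \<ge> 0\<close> by simp
    then show "t \<in> \<nat>"
      by simp
  qed
  moreover have "finite (\<nat> - sumset_power 4 ?A)"
  proof (rule finite_subset)
    show "finite (real ` {n. n \<le> nat \<lfloor>?K\<rfloor>})"
      by simp
    show "\<nat> - sumset_power 4 ?A \<subseteq> real ` {n. n \<le> nat \<lfloor>?K\<rfloor>}"
    proof
      fix t assume t: "t \<in> \<nat> - sumset_power 4 ?A"
      then obtain n where n: "t = real n"
        by (auto elim: Nats_cases)
      have "\<not> real n > ?K"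
      proof
        assume "real n > ?K"
        then obtain w x y z where "real n = ?f w + ?f x + ?f y + ?f z"
          using rep by blast
        \<comment> \<open>A list serves as the indexed family required by
          \<open>sumset_power\<close>.\<close>
        then have "real n = (\<Sum>i<4. [?f w, ?f x, ?f y, ?f z] ! i)"
          by (simp add: eval_nat_numeral)
        moreover have "\<forall>i<4. [?f w, ?f x, ?f y, ?f z] ! i \<in> ?A"
          by (auto simp: eval_nat_numeral less_Suc_eq)
        ultimately have "t \<in> sumset_power 4 ?A"
          unfolding sumset_power_def n by blast
        then show False
          using t by blast
      qed
      then have "n \<le> nat \<lfloor>?K\<rfloor>"
        by linarith
      then show "t \<in> real ` {n. n \<le> nat \<lfloor>?K\<rfloor>}"
        unfolding n by blast
    qed
  qed
  ultimately show ?thesis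
    using rep unfolding asymptotic_base_def by blast
qed

end
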